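(* Let $\mathcal{C}$ be a category with finite limits, and let $X$ be an exponentiable object of $\mathcal{C}$. Let $p:Y\to X$ be an object $\underline{Y}$ of the slice category $\mathcal{C}/X$, let $Z$ be an object of $\mathcal{C}$, and suppose that the exponential $\underline{Z}^{\underline{Y}}$ exists in $\mathcal{C}/X$, where $\underline{Z}$ denotes the object $\pi_2: Z\times X\to X$ of $\mathcal{C}/X$. Then the exponential $Z^{Y}$ exists in $\mathcal{C}$.
   Context: An object $X$ of a category with finite products is exponentiable if the functor $(-)\times X$ has a right adjoint $(-)^X$. For two objects $Y,Z$, "the exponential $Z^Y$ exists" means that there is an object $Z^Y$ with an evaluation morphism $Z^Y\times Y\to Z$ such that every morphism $W\times Y\to Z$ factors as $\mathrm{ev}\circ(\tilde g\times \mathrm{id}_Y)$ for a unique $\tilde g: W\to Z^Y$. Exponentials in $\mathcal{C}/X$ are with respect to the products of $\mathcal{C}/X$, i.e. pullbacks over $X$. *)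

theory Defs
  imports Main
begin

section \<open>Categories\<close>

record ('o, 'm) category_data =
  Ob :: "'o set"
  Ar :: "'m set"
  Dom :: "'m \<Rightarrow> 'o"
  Cod :: "'m \<Rightarrow> 'o"
  Idt :: "'o \<Rightarrow> 'm"
  Comp :: "'m \<Rightarrow> 'm \<Rightarrow> 'm"  (infixr "\<cdot>\<index>" 70)

definition hom :: "('o, 'm) category_data \<Rightarrow> 'o \<Rightarrow> 'o \<Rightarrow> 'm set" where
  "hom C A B = {f \<in> Ar C. Dom C f = A \<and> Cod C f = B}"

text \<open>The values of the operations outside the carriers, and of composition on
  non-composable pairs, are unconstrained.\<close>

locale category =
  fixes C :: "('o, 'm) category_data" (structure)
  assumes Dom_Ob: "f \<in> Ar C \<Longrightarrow> Dom C f \<in> Ob C"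
    and Cod_Ob: "f \<in> Ar C \<Longrightarrow> Cod C f \<in> Ob C"
    and Idt_hom: "A \<in> Ob C \<Longrightarrow> Idt C A \<in> hom C A A"
    and Comp_hom: "f \<in> hom C A B \<Longrightarrow> g \<in> hom C B D \<Longrightarrow> g \<cdot> f \<in> hom C A D"
    and Comp_Idt_right: "f \<in> hom C A B \<Longrightarrow> f \<cdot> Idt C A = f"
    and Comp_Idt_left: "f \<in> hom C A B \<Longrightarrow> Idt C B \<cdot> f = f"
    and Comp_assoc: "f \<in> hom C A B \<Longrightarrow> g \<in> hom C B D \<Longrightarrow> h \<in> hom C D E \<Longrightarrow>
      (h \<cdot> g) \<cdot> f = h \<cdot> (g \<cdot> f)"


section \<open>Functors and adjunctions\<close>

record ('o1, 'm1, 'o2, 'm2) functor_data =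
  onOb :: "'o1 \<Rightarrow> 'o2"
  onAr :: "'m1 \<Rightarrow> 'm2"

locale category_functor = A: category A + B: category B
  for A :: "('o1, 'm1) category_data" and B :: "('o2, 'm2) category_data" +
  fixes F :: "('o1, 'm1, 'o2, 'm2) functor_data"
  assumes onOb_Ob: "a \<in> Ob A \<Longrightarrow> onOb F a \<in> Ob B"
    and onAr_hom: "f \<in> hom A a a' \<Longrightarrow> onAr F f \<in> hom B (onOb F a) (onOb F a')"
    and onAr_Idt: "a \<in> Ob A \<Longrightarrow> onAr F (Idt A a) = Idt B (onOb F a)"
    and onAr_Comp: "f \<in> hom A a a' \<Longrightarrow> g \<in> hom A a' a'' \<Longrightarrow>
      onAr F (g \<cdot>\<^bsub>A\<^esub> f) = onAr F g \<cdot>\<^bsub>B\<^esub> onAr F f"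

definition id_functor :: "('o, 'm, 'o, 'm) functor_data" where
  "id_functor = \<lparr>onOb = (\<lambda>a. a), onAr = (\<lambda>f. f)\<rparr>"

definition comp_functor ::
  "('o2, 'm2, 'o3, 'm3) functor_data \<Rightarrow> ('o1, 'm1, 'o2, 'm2) functor_data
    \<Rightarrow> ('o1, 'm1, 'o3, 'm3) functor_data" where
  "comp_functor G F = \<lparr>onOb = (\<lambda>a. onOb G (onOb F a)), onAr = (\<lambda>f. onAr G (onAr F f))\<rparr>"

locale natural_transformation = F: category_functor A B F + G: category_functor A B G
  for A :: "('o1, 'm1) category_data" and B :: "('o2, 'm2) category_data"
    and F G :: "('o1, 'm1, 'o2, 'm2) functor_data" +
  fixes \<tau> :: "'o1 \<Rightarrow> 'm2"
  assumes component_hom: "a \<in> Ob A \<Longrightarrow> \<tau> a \<in> hom B (onOb F a) (onOb G a)"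
    and naturality: "f \<in> hom A a a' \<Longrightarrow> onAr G f \<cdot>\<^bsub>B\<^esub> \<tau> a = \<tau> a' \<cdot>\<^bsub>B\<^esub> onAr F f"

locale adjunction = F: category_functor A B F + G: category_functor B A G +
  unit: natural_transformation A A id_functor "comp_functor G F" \<eta> +
  counit: natural_transformation B B "comp_functor F G" id_functor \<epsilon>
  for A :: "('o1, 'm1) category_data" and B :: "('o2, 'm2) category_data"
    and F :: "('o1, 'm1, 'o2, 'm2) functor_data" and G :: "('o2, 'm2, 'o1, 'm1) functor_data"
    and \<eta> :: "'o1 \<Rightarrow> 'm1" and \<epsilon> :: "'o2 \<Rightarrow> 'm2" +
  assumes triangle_left: "a \<in> Ob A \<Longrightarrow> \<epsilon> (onOb F a) \<cdot>\<^bsub>B\<^esub> onAr F (\<eta> a) = Idt B (onOb F a)"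
    and triangle_right: "b \<in> Ob B \<Longrightarrow> onAr G (\<epsilon> b) \<cdot>\<^bsub>A\<^esub> \<eta> (onOb G b) = Idt A (onOb G b)"

definition has_right_adjoint ::
  "('o1, 'm1) category_data \<Rightarrow> ('o2, 'm2) category_data
    \<Rightarrow> ('o1, 'm1, 'o2, 'm2) functor_data \<Rightarrow> bool" where
  "has_right_adjoint A B F \<longleftrightarrow> (\<exists>G \<eta> \<epsilon>. adjunction A B F G \<eta> \<epsilon>)"


section \<open>Finite limits\<close>

definition is_cone ::
  "('o1, 'm1) category_data \<Rightarrow> ('o2, 'm2) category_data
    \<Rightarrow> ('o1, 'm1, 'o2, 'm2) functor_data \<Rightarrow> 'o2 \<Rightarrow> ('o1 \<Rightarrow> 'm2) \<Rightarrow> bool" where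
  "is_cone J C D L \<pi> \<longleftrightarrow>
     L \<in> Ob C \<and> (\<forall>j\<in>Ob J. \<pi> j \<in> hom C L (onOb D j)) \<and>
     (\<forall>u\<in>Ar J. onAr D u \<cdot>\<^bsub>C\<^esub> \<pi> (Dom J u) = \<pi> (Cod J u))"

definition is_limit ::
  "('o1, 'm1) category_data \<Rightarrow> ('o2, 'm2) category_data
    \<Rightarrow> ('o1, 'm1, 'o2, 'm2) functor_data \<Rightarrow> 'o2 \<Rightarrow> ('o1 \<Rightarrow> 'm2) \<Rightarrow> bool" where
  "is_limit J C D L \<pi> \<longleftrightarrow>
     is_cone J C D L \<pi> \<and>
     (\<forall>W \<omega>. is_cone J C D W \<omega> \<longrightarrow>
       (\<exists>!h. h \<in> hom C W L \<and> (\<forall>j\<in>Ob J. \<pi> j \<cdot>\<^bsub>C\<^esub> h = \<omega> j)))"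

text \<open>Every finite category is isomorphic to one whose objects and arrows are natural
  numbers, so it suffices to let the index category range over those.\<close>

definition has_finite_limits :: "('o, 'm) category_data \<Rightarrow> bool" where
  "has_finite_limits C \<longleftrightarrow>
     (\<forall>(J :: (nat, nat) category_data) D.
        category J \<and> finite (Ob J) \<and> finite (Ar J) \<and> category_functor J C D \<longrightarrow>
        (\<exists>L \<pi>. is_limit J C D L \<pi>))"


section \<open>Binary products\<close>

definition is_product ::
  "('o, 'm) category_data \<Rightarrow> 'o \<Rightarrow> 'o \<Rightarrow> 'o \<Rightarrow> 'm \<Rightarrow> 'm \<Rightarrow> bool" where
  "is_product C A B P p q \<longleftrightarrow>
     P \<in> Ob C \<and> p \<in> hom C P A \<and> q \<in> hom C P B \<and>
     (\<forall>W f g. f \<in> hom C W A \<longrightarrow> g \<in> hom C W B \<longrightarrow>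
       (\<exists>!h. h \<in> hom C W P \<and> p \<cdot>\<^bsub>C\<^esub> h = f \<and> q \<cdot>\<^bsub>C\<^esub> h = g))"

text \<open>A product diagram is selected for every pair of objects; the selection is meaningful
  whenever a product exists.\<close>

definition chosen_product :: "('o, 'm) category_data \<Rightarrow> 'o \<Rightarrow> 'o \<Rightarrow> 'o \<times> 'm \<times> 'm" where
  "chosen_product C A B = (SOME (P, p, q). is_product C A B P p q)"

definition prod_ob :: "('o, 'm) category_data \<Rightarrow> 'o \<Rightarrow> 'o \<Rightarrow> 'o" where
  "prod_ob C A B = fst (chosen_product C A B)"

definition proj1 :: "('o, 'm) category_data \<Rightarrow> 'o \<Rightarrow> 'o \<Rightarrow> 'm" where
  "proj1 C A B = fst (snd (chosen_product C A B))"

definition proj2 :: "('o, 'm) category_data \<Rightarrow> 'o \<Rightarrow> 'o \<Rightarrow> 'm" where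
  "proj2 C A B = snd (snd (chosen_product C A B))"

definition prod_ar :: "('o, 'm) category_data \<Rightarrow> 'm \<Rightarrow> 'm \<Rightarrow> 'm" where
  "prod_ar C f g =
     (THE h. h \<in> hom C (prod_ob C (Dom C f) (Dom C g)) (prod_ob C (Cod C f) (Cod C g)) \<and>
       proj1 C (Cod C f) (Cod C g) \<cdot>\<^bsub>C\<^esub> h = f \<cdot>\<^bsub>C\<^esub> proj1 C (Dom C f) (Dom C g) \<and>
       proj2 C (Cod C f) (Cod C g) \<cdot>\<^bsub>C\<^esub> h = g \<cdot>\<^bsub>C\<^esub> proj2 C (Dom C f) (Dom C g))"

definition prod_functor :: "('o, 'm) category_data \<Rightarrow> 'o \<Rightarrow> ('o, 'm, 'o, 'm) functor_data" where
  "prod_functor C X = \<lparr>onOb = (\<lambda>A. prod_ob C A X), onAr = (\<lambda>f. prod_ar C f (Idt C X))\<rparr>"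


section \<open>Exponentials\<close>

definition exponentiable :: "('o, 'm) category_data \<Rightarrow> 'o \<Rightarrow> bool" where
  "exponentiable C X \<longleftrightarrow> X \<in> Ob C \<and> has_right_adjoint C C (prod_functor C X)"

text \<open>In \<open>is_exponential C Y Z E ev\<close> the object \<open>Y\<close> is the exponent and \<open>Z\<close> the base, so that
  \<open>E\<close> plays the role of \<open>Z\<^sup>Y\<close>; likewise for \<open>has_exponential\<close>.\<close>

definition is_exponential ::
  "('o, 'm) category_data \<Rightarrow> 'o \<Rightarrow> 'o \<Rightarrow> 'o \<Rightarrow> 'm \<Rightarrow> bool" where
  "is_exponential C Y Z E ev \<longleftrightarrow>
     E \<in> Ob C \<and> ev \<in> hom C (prod_ob C E Y) Z \<and>
     (\<forall>W\<in>Ob C. \<forall>g\<in>hom C (prod_ob C W Y) Z.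
       \<exists>!g'. g' \<in> hom C W E \<and> g = ev \<cdot>\<^bsub>C\<^esub> prod_ar C g' (Idt C Y))"

definition has_exponential :: "('o, 'm) category_data \<Rightarrow> 'o \<Rightarrow> 'o \<Rightarrow> bool" where
  "has_exponential C Y Z \<longleftrightarrow> (\<exists>E ev. is_exponential C Y Z E ev)"


section \<open>Slice categories\<close>

text \<open>An object of the slice over \<open>X\<close> is an arrow into \<open>X\<close>.  An arrow is a triple
  \<open>(p, f, q)\<close> with \<open>q \<cdot> f = p\<close>: the same \<open>f\<close> may underlie arrows with different sources and
  targets, so these are recorded.\<close>

definition slice :: "('o, 'm) category_data \<Rightarrow> 'o \<Rightarrow> ('m, 'm \<times> 'm \<times> 'm) category_data" where
  "slice C X =
     \<lparr>Ob = {p \<in> Ar C. Cod C p = X},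
      Ar = {(p, f, q). p \<in> Ar C \<and> Cod C p = X \<and> q \<in> Ar C \<and> Cod C q = X \<and>
              f \<in> hom C (Dom C p) (Dom C q) \<and> q \<cdot>\<^bsub>C\<^esub> f = p},
      Dom = (\<lambda>(p, f, q). p),
      Cod = (\<lambda>(p, f, q). q),
      Idt = (\<lambda>p. (p, Idt C (Dom C p), p)),
      Comp = (\<lambda>(q, g, r) (p, f, q'). (p, g \<cdot>\<^bsub>C\<^esub> f, r))\<rparr>"

lemma slice_simps:
  "Ob (slice C X) = {p \<in> Ar C. Cod C p = X}"
  "hom (slice C X) p q = {(p', f, q'). p' = p \<and> q' = q \<and> p \<in> Ar C \<and> Cod C p = X \<and>
     q \<in> Ar C \<and> Cod C q = X \<and> f \<in> hom C (Dom C p) (Dom C q) \<and> q \<cdot>\<^bsub>C\<^esub> f = p}"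
  "Idt (slice C X) p = (p, Idt C (Dom C p), p)"
  "(q, g, r) \<cdot>\<^bsub>slice C X\<^esub> (p, f, q') = (p, g \<cdot>\<^bsub>C\<^esub> f, r)"
  by (auto simp: slice_def hom_def)

lemma (in category) category_slice: "category (slice C X)"
proof
  have arr: "p \<in> hom C (Dom C p) X" if "p \<in> Ar C" "Cod C p = X" for p
    using that by (simp add: hom_def)
  show "Dom (slice C X) f \<in> Ob (slice C X)" "Cod (slice C X) f \<in> Ob (slice C X)"
    if "f \<in> Ar (slice C X)" for f
    using that by (auto simp: slice_def)
  show "Idt (slice C X) p \<in> hom (slice C X) p p" if "p \<in> Ob (slice C X)" for p
    using that by (auto simp: slice_simps Idt_hom Dom_Ob intro: Comp_Idt_right arr)
  show "b \<cdot>\<^bsub>slice C X\<^esub> a \<in> hom (slice C X) p r"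
    if a: "a \<in> hom (slice C X) p q" and b: "b \<in> hom (slice C X) q r" for a b p q r
  proof -
    obtain f where f: "a = (p, f, q)" "f \<in> hom C (Dom C p) (Dom C q)" "q \<cdot> f = p"
      "p \<in> Ar C" "Cod C p = X"
      using a by (auto simp: slice_simps)
    obtain g where g: "b = (q, g, r)" "g \<in> hom C (Dom C q) (Dom C r)" "r \<cdot> g = q"
      "r \<in> Ar C" "Cod C r = X"
      using b by (auto simp: slice_simps)
    have "r \<cdot> (g \<cdot> f) = p"
      using Comp_assoc[OF f(2) g(2) arr[OF g(4,5)]] f(3) g(3) by simp
    then show ?thesis
      using f g Comp_hom[OF f(2) g(2)] by (simp add: slice_simps)
  qed
  show "a \<cdot>\<^bsub>slice C X\<^esub> Idt (slice C X) p = a" "Idt (slice C X) q \<cdot>\<^bsub>slice C X\<^esub> a = a"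
    if "a \<in> hom (slice C X) p q" for a p q
    using that by (auto simp: slice_simps Comp_Idt_right Comp_Idt_left)
  show "(c \<cdot>\<^bsub>slice C X\<^esub> b) \<cdot>\<^bsub>slice C X\<^esub> a = c \<cdot>\<^bsub>slice C X\<^esub> (b \<cdot>\<^bsub>slice C X\<^esub> a)"
    if "a \<in> hom (slice C X) p q" "b \<in> hom (slice C X) q r" "c \<in> hom (slice C X) r s"
    for a b c p q r s
    using that by (auto simp: slice_simps intro: Comp_assoc)
qed

end

theory Submission
  imports Defs
begin

text \<open>Let \<open>q : E \<rightarrow> X\<close> be the exponential in the slice.  Since \<open>X\<close> is exponentiable, the functor
  \<open>- \<times> X\<close> from \<open>C\<close> to the slice has a right adjoint at \<open>q\<close>: its value \<open>S\<close> is the object of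
  sections of \<open>q\<close>, the equalizer of the two arrows \<open>E\<^sup>X \<rightarrow> X\<^sup>X\<close> that transpose \<open>q \<cdot> ev\<close>
  and the second projection.  As \<open>W \<times> Y\<close> is the pullback of \<open>W \<times> X \<rightarrow> X\<close> along \<open>p\<close>, arrows
  \<open>W \<rightarrow> S\<close> correspond to slice arrows \<open>W \<times> X \<rightarrow> E\<close>, hence to slice arrows from \<open>W \<times> Y\<close>
  to \<open>Z \<times> X\<close>, hence to arrows \<open>W \<times> Y \<rightarrow> Z\<close>.  So \<open>S\<close> is \<open>Z\<^sup>Y\<close>.\<close>

section \<open>Products, equalizers and pullbacks\<close>

definition is_equalizer :: "('o, 'm) category_data \<Rightarrow> 'm \<Rightarrow> 'm \<Rightarrow> 'o \<Rightarrow> 'm \<Rightarrow> bool" where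
  "is_equalizer C u v L m \<longleftrightarrow>
     L \<in> Ob C \<and> m \<in> hom C L (Dom C u) \<and> u \<cdot>\<^bsub>C\<^esub> m = v \<cdot>\<^bsub>C\<^esub> m \<and>
     (\<forall>W h. h \<in> hom C W (Dom C u) \<longrightarrow> u \<cdot>\<^bsub>C\<^esub> h = v \<cdot>\<^bsub>C\<^esub> h \<longrightarrow>
       (\<exists>!k. k \<in> hom C W L \<and> m \<cdot>\<^bsub>C\<^esub> k = h))"

definition is_pullback ::
  "('o, 'm) category_data \<Rightarrow> 'm \<Rightarrow> 'm \<Rightarrow> 'o \<Rightarrow> 'm \<Rightarrow> 'm \<Rightarrow> bool" where
  "is_pullback C f g P a b \<longleftrightarrow>
     P \<in> Ob C \<and> a \<in> hom C P (Dom C f) \<and> b \<in> hom C P (Dom C g) \<and>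
     f \<cdot>\<^bsub>C\<^esub> a = g \<cdot>\<^bsub>C\<^esub> b \<and>
     (\<forall>W a' b'. a' \<in> hom C W (Dom C f) \<longrightarrow> b' \<in> hom C W (Dom C g) \<longrightarrow>
       f \<cdot>\<^bsub>C\<^esub> a' = g \<cdot>\<^bsub>C\<^esub> b' \<longrightarrow>
       (\<exists>!h. h \<in> hom C W P \<and> a \<cdot>\<^bsub>C\<^esub> h = a' \<and> b \<cdot>\<^bsub>C\<^esub> h = b'))"

text \<open>The two-object category without non-identity arrows: each number is an object and also
  its own identity. The only composable pairs are \<open>(i, i)\<close>, so the value given to
  \<open>Comp\<close> elsewhere is arbitrary.\<close>

definition discrete_pair :: "(nat, nat) category_data" where
  "discrete_pair = \<lparr>Ob = {0, 1}, Ar = {0, 1}, Dom = (\<lambda>i. i), Cod = (\<lambda>i. i),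
     Idt = (\<lambda>i. i), Comp = (\<lambda>j i. i)\<rparr>"

text \<open>The arrows \<open>0\<close> and \<open>1\<close> are the identities, \<open>2\<close> and \<open>3\<close> the parallel arrows.\<close>

definition parallel_pair :: "(nat, nat) category_data" where
  "parallel_pair = \<lparr>Ob = {0, 1}, Ar = {0, 1, 2, 3}, Dom = (\<lambda>i. if i = 1 then 1 else 0),
     Cod = (\<lambda>i. if i = 0 then 0 else 1), Idt = (\<lambda>i. i),
     Comp = (\<lambda>j i. if i < 2 then j else i)\<rparr>"

lemma discrete_pair_simps:
  "Ob discrete_pair = {0, 1}" "Ar discrete_pair = {0, 1}"
  "Dom discrete_pair i = i" "Cod discrete_pair i = i" "Idt discrete_pair i = i"
  "j \<cdot>\<^bsub>discrete_pair\<^esub> i = i"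
  "f \<in> hom discrete_pair i j \<longleftrightarrow> f \<in> {0, 1} \<and> i = f \<and> j = f"
  by (auto simp: discrete_pair_def hom_def)

lemma parallel_pair_simps:
  "Ob parallel_pair = {0, 1}" "Ar parallel_pair = {0, 1, 2, 3}"
  "Dom parallel_pair i = (if i = 1 then 1 else 0)" "Cod parallel_pair i = (if i = 0 then 0 else 1)"
  "Idt parallel_pair i = i" "j \<cdot>\<^bsub>parallel_pair\<^esub> i = (if i < 2 then j else i)"
  "f \<in> hom parallel_pair i j \<longleftrightarrow> f = 0 \<and> i = 0 \<and> j = 0 \<or> f = 1 \<and> i = 1 \<and> j = 1 \<or>
    f = 2 \<and> i = 0 \<and> j = 1 \<or> f = 3 \<and> i = 0 \<and> j = 1"
  by (auto simp: parallel_pair_def hom_def)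

lemma category_discrete_pair: "category discrete_pair"
  by unfold_locales (auto simp: discrete_pair_simps)

lemma category_parallel_pair: "category parallel_pair"
  by unfold_locales (auto simp: parallel_pair_simps)

context category
begin

lemma hom_Ob: "f \<in> hom C A B \<Longrightarrow> A \<in> Ob C \<and> B \<in> Ob C"
  using Dom_Ob Cod_Ob by (auto simp: hom_def)

lemma hom_DomCod: "f \<in> hom C A B \<Longrightarrow> Dom C f = A \<and> Cod C f = B"
  by (simp add: hom_def)

lemma product_exists:
  assumes "has_finite_limits C" "A \<in> Ob C" "B \<in> Ob C"
  shows "\<exists>P a b. is_product C A B P a b"
proof -
  define D :: "(nat, nat, 'o, 'm) functor_data" where
    "D = \<lparr>onOb = (\<lambda>i. if i = 0 then A else B), onAr = (\<lambda>i. Idt C (if i = 0 then A else B))\<rparr>"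
  have "category_functor discrete_pair C D"
    unfolding category_functor_def category_functor_axioms_def
    using assms(2,3) Idt_hom Comp_Idt_left[OF Idt_hom]
    by (auto simp: category_discrete_pair category_axioms D_def discrete_pair_simps)
  moreover have "finite (Ob discrete_pair)" "finite (Ar discrete_pair)"
    by (simp_all add: discrete_pair_simps)
  ultimately obtain P \<pi> where lim: "is_limit discrete_pair C D P \<pi>"
    using assms(1) category_discrete_pair unfolding has_finite_limits_def by blast
  \<comment> \<open>The compatibility equations of a cone concern identities only, so they hold
    automatically and a cone is just a pair of legs.\<close>
  have cone: "is_cone discrete_pair C D W \<omega> \<longleftrightarrow> \<omega> 0 \<in> hom C W A \<and> \<omega> 1 \<in> hom C W B" for W \<omega>
    using hom_Ob by (auto simp: is_cone_def discrete_pair_simps D_def Comp_Idt_left)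
  have "is_product C A B P (\<pi> 0) (\<pi> 1)"
    unfolding is_product_def
  proof (intro conjI allI impI)
    show "P \<in> Ob C" "\<pi> 0 \<in> hom C P A" "\<pi> 1 \<in> hom C P B"
      using lim hom_Ob unfolding is_limit_def cone by blast+
    fix W f g assume fg: "f \<in> hom C W A" "g \<in> hom C W B"
    let ?\<omega> = "\<lambda>i :: nat. if i = 0 then f else g"
    have "is_cone discrete_pair C D W ?\<omega>"
      using fg by (simp add: cone)
    then have "\<exists>!h. h \<in> hom C W P \<and> (\<forall>j\<in>Ob discrete_pair. \<pi> j \<cdot> h = ?\<omega> j)"
      using lim unfolding is_limit_def by blast
    then show "\<exists>!h. h \<in> hom C W P \<and> \<pi> 0 \<cdot> h = f \<and> \<pi> 1 \<cdot> h = g"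
      by (simp add: discrete_pair_simps)
  qed
  then show ?thesis by blast
qed

lemma equalizer_exists:
  assumes "has_finite_limits C" and u: "u \<in> hom C A B" and v: "v \<in> hom C A B"
  shows "\<exists>L m. is_equalizer C u v L m"
proof -
  have Ob: "A \<in> Ob C" "B \<in> Ob C"
    using hom_Ob[OF u] by auto
  define D :: "(nat, nat, 'o, 'm) functor_data" where
    "D = \<lparr>onOb = (\<lambda>i. if i = 0 then A else B),
          onAr = (\<lambda>i. if i = 0 then Idt C A else if i = 1 then Idt C B
                      else if i = 2 then u else v)\<rparr>"
  have "category_functor parallel_pair C D"
    unfolding category_functor_def category_functor_axioms_def
    using Ob Idt_hom Comp_Idt_left[OF Idt_hom] u v Comp_Idt_left[OF u] Comp_Idt_left[OF v]
      Comp_Idt_right[OF u] Comp_Idt_right[OF v]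
    by (auto simp: category_parallel_pair category_axioms D_def parallel_pair_simps)
  moreover have "finite (Ob parallel_pair)" "finite (Ar parallel_pair)"
    by (simp_all add: parallel_pair_simps)
  ultimately obtain L \<pi> where lim: "is_limit parallel_pair C D L \<pi>"
    using assms(1) category_parallel_pair unfolding has_finite_limits_def by blast
  \<comment> \<open>The leg at \<open>1\<close> is forced to be the common composite of the leg at
    \<open>0\<close> with \<open>u\<close> and \<open>v\<close>, so a cone amounts to an arrow
    equalizing \<open>u\<close> and \<open>v\<close>.\<close>
  have cone: "is_cone parallel_pair C D W \<omega> \<longleftrightarrow>
      \<omega> 0 \<in> hom C W A \<and> u \<cdot> \<omega> 0 = \<omega> 1 \<and> v \<cdot> \<omega> 0 = \<omega> 1" for W \<omega>
  proof -
    have "\<omega> 1 \<in> hom C W B \<and> Idt C B \<cdot> \<omega> 1 = \<omega> 1" if "\<omega> 0 \<in> hom C W A" "u \<cdot> \<omega> 0 = \<omega> 1"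
      using Comp_hom[OF that(1) u] that(2) Comp_Idt_left by auto
    then show ?thesis
      using hom_Ob by (auto simp: is_cone_def parallel_pair_simps D_def Comp_Idt_left)
  qed
  have m: "\<pi> 0 \<in> hom C L A" "u \<cdot> \<pi> 0 = \<pi> 1" "v \<cdot> \<pi> 0 = \<pi> 1"
    using lim unfolding is_limit_def cone by blast+
  have "is_equalizer C u v L (\<pi> 0)"
    unfolding is_equalizer_def hom_DomCod[OF u, THEN conjunct1]
  proof (intro conjI allI impI)
    show "L \<in> Ob C" "\<pi> 0 \<in> hom C L A" "u \<cdot> \<pi> 0 = v \<cdot> \<pi> 0"
      using m hom_Ob by auto
    fix W h assume h: "h \<in> hom C W A" "u \<cdot> h = v \<cdot> h"
    let ?\<omega> = "\<lambda>i :: nat. if i = 0 then h else u \<cdot> h"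
    have "is_cone parallel_pair C D W ?\<omega>"
      using h by (simp add: cone)
    then have "\<exists>!k. k \<in> hom C W L \<and> (\<forall>j\<in>Ob parallel_pair. \<pi> j \<cdot> k = ?\<omega> j)"
      using lim unfolding is_limit_def by blast
    moreover have "\<pi> 1 \<cdot> k = u \<cdot> h" if "k \<in> hom C W L" "\<pi> 0 \<cdot> k = h" for k
      using Comp_assoc[OF that(1) m(1) u] m(2) that(2) by simp
    ultimately show "\<exists>!k. k \<in> hom C W L \<and> \<pi> 0 \<cdot> k = h"
      by (auto simp: parallel_pair_simps)
  qed
  then show ?thesis by blast
qed

text \<open>The usual construction: on a product \<open>Q\<close> of \<open>A\<close> and
  \<open>B\<close>, equalize the two composites to \<open>X\<close>.\<close>

lemma pullback_exists:
  assumes lim: "has_finite_limits C" and f: "f \<in> hom C A X" and g: "g \<in> hom C B X"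
  shows "\<exists>P a b. is_pullback C f g P a b"
proof -
  obtain Q s t where Q: "is_product C A B Q s t"
    using product_exists[OF lim] hom_Ob f g by blast
  then have s: "s \<in> hom C Q A" and t: "t \<in> hom C Q B"
    by (auto simp: is_product_def)
  note fs = Comp_hom[OF s f] and gt = Comp_hom[OF t g]
  obtain L m where L: "is_equalizer C (f \<cdot> s) (g \<cdot> t) L m"
    using equalizer_exists[OF lim fs gt] by blast
  then have m: "m \<in> hom C L Q"
    using hom_DomCod[OF fs] by (simp add: is_equalizer_def)
  have "is_pullback C f g L (s \<cdot> m) (t \<cdot> m)"
    unfolding is_pullback_def hom_DomCod[OF f, THEN conjunct1] hom_DomCod[OF g, THEN conjunct1]
  proof (intro conjI allI impI)
    show "L \<in> Ob C" "s \<cdot> m \<in> hom C L A" "t \<cdot> m \<in> hom C L B"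
      using hom_Ob[OF m] Comp_hom[OF m] s t by auto
    show "f \<cdot> (s \<cdot> m) = g \<cdot> (t \<cdot> m)"
      using L Comp_assoc[OF m s f] Comp_assoc[OF m t g] by (simp add: is_equalizer_def)
    fix W a b assume a: "a \<in> hom C W A" and b: "b \<in> hom C W B" and ab: "f \<cdot> a = g \<cdot> b"
    have "\<exists>!h. h \<in> hom C W Q \<and> s \<cdot> h = a \<and> t \<cdot> h = b"
      using Q a b unfolding is_product_def by blast
    then obtain h where h: "h \<in> hom C W Q" "s \<cdot> h = a" "t \<cdot> h = b"
      and huniq: "\<And>h'. h' \<in> hom C W Q \<Longrightarrow> s \<cdot> h' = a \<Longrightarrow> t \<cdot> h' = b \<Longrightarrow> h' = h"
      by blast
    have "(f \<cdot> s) \<cdot> h = (g \<cdot> t) \<cdot> h"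
      using Comp_assoc[OF h(1) s f] Comp_assoc[OF h(1) t g] h ab by simp
    then have ex: "\<exists>!k. k \<in> hom C W L \<and> m \<cdot> k = h"
      using L h(1) hom_DomCod[OF fs] unfolding is_equalizer_def by simp
    \<comment> \<open>Arrows into \<open>Q\<close> are determined by their two components, so the
      uniqueness given by the equalizer becomes the uniqueness required of the pullback.\<close>
    have "m \<cdot> k = h \<longleftrightarrow> (s \<cdot> m) \<cdot> k = a \<and> (t \<cdot> m) \<cdot> k = b" if "k \<in> hom C W L" for k
      using huniq[OF Comp_hom[OF that m]] h Comp_assoc[OF that m s] Comp_assoc[OF that m t]
      by auto
    with ex show "\<exists>!k. k \<in> hom C W L \<and> (s \<cdot> m) \<cdot> k = a \<and> (t \<cdot> m) \<cdot> k = b"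
      by (metis (no_types, lifting))
  qed
  then show ?thesis by blast
qed

section \<open>Products in the slice from pullbacks in the base\<close>

lemma slice_hom_iff:
  assumes "f \<in> hom C A X" "g \<in> hom C B X"
  shows "(f', k, g') \<in> hom (slice C X) f g \<longleftrightarrow> f' = f \<and> g' = g \<and> k \<in> hom C A B \<and> g \<cdot> k = f"
  using assms by (auto simp: slice_simps hom_def[of C A] hom_def[of C B] hom_def[of C _ X])

lemma slice_homE:
  assumes "\<phi> \<in> hom (slice C X) f g"
  obtains k A B where "\<phi> = (f, k, g)" "f \<in> hom C A X" "g \<in> hom C B X" "k \<in> hom C A B"
    "g \<cdot> k = f"
  using assms by (auto simp: slice_simps hom_def[of C])

lemma slice_ObE:
  assumes "f \<in> Ob (slice C X)" obtains A where "f \<in> hom C A X"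
  using assms by (auto simp: slice_simps hom_def[of C])

text \<open>A pair of slice arrows from \<open>w\<close> to \<open>f\<close> and \<open>g\<close> is
  a commuting square over the cospan \<open>f\<close>, \<open>g\<close> whose diagonal is
  \<open>w\<close>. Any pullback is allowed here, so that \<open>W \<times> Y\<close> can later
  serve as the product of \<open>W \<times> X\<close> and \<open>Y\<close> over
  \<open>X\<close>.\<close>

lemma slice_product_of_pullback:
  assumes f: "f \<in> hom C A X" and g: "g \<in> hom C B X" and P: "is_pullback C f g P a b"
  shows "is_product (slice C X) f g (f \<cdot> a) (f \<cdot> a, a, f) (f \<cdot> a, b, g)"
proof -
  have a: "a \<in> hom C P A" and b: "b \<in> hom C P B" and ab: "f \<cdot> a = g \<cdot> b"
    and univ: "\<And>W a' b'. a' \<in> hom C W A \<Longrightarrow> b' \<in> hom C W B \<Longrightarrow> f \<cdot> a' = g \<cdot> b' \<Longrightarrow>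
       (\<exists>!h. h \<in> hom C W P \<and> a \<cdot> h = a' \<and> b \<cdot> h = b')"
    using P hom_DomCod[OF f] hom_DomCod[OF g] by (auto simp: is_pullback_def)
  note fa = Comp_hom[OF a f]
  show ?thesis
    unfolding is_product_def
  proof (intro conjI allI impI)
    show "f \<cdot> a \<in> Ob (slice C X)" using fa by (simp add: slice_simps hom_def)
    show "(f \<cdot> a, a, f) \<in> hom (slice C X) (f \<cdot> a) f" "(f \<cdot> a, b, g) \<in> hom (slice C X) (f \<cdot> a) g"
      using slice_hom_iff[OF fa f] slice_hom_iff[OF fa g] a b ab by simp_all
    fix w \<phi> \<psi> assume \<phi>: "\<phi> \<in> hom (slice C X) w f" and \<psi>: "\<psi> \<in> hom (slice C X) w g"
    obtain W where w: "w \<in> hom C W X" using \<phi> by (rule slice_homE)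
    obtain a' where a': "\<phi> = (w, a', f)" "a' \<in> hom C W A" "f \<cdot> a' = w"
      using \<phi> slice_hom_iff[OF w f] by (cases \<phi>) auto
    obtain b' where b': "\<psi> = (w, b', g)" "b' \<in> hom C W B" "g \<cdot> b' = w"
      using \<psi> slice_hom_iff[OF w g] by (cases \<psi>) auto
    obtain h where h: "h \<in> hom C W P" "a \<cdot> h = a'" "b \<cdot> h = b'"
      and huniq: "\<And>h'. h' \<in> hom C W P \<Longrightarrow> a \<cdot> h' = a' \<Longrightarrow> b \<cdot> h' = b' \<Longrightarrow> h' = h"
      using univ[OF a'(2) b'(2)] a' b' by (metis (no_types, lifting))
    show "\<exists>!\<chi>. \<chi> \<in> hom (slice C X) w (f \<cdot> a) \<and>
        (f \<cdot> a, a, f) \<cdot>\<^bsub>slice C X\<^esub> \<chi> = \<phi> \<and> (f \<cdot> a, b, g) \<cdot>\<^bsub>slice C X\<^esub> \<chi> = \<psi>"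
    proof (rule ex1I[of _ "(w, h, f \<cdot> a)"])
      show "(w, h, f \<cdot> a) \<in> hom (slice C X) w (f \<cdot> a) \<and>
        (f \<cdot> a, a, f) \<cdot>\<^bsub>slice C X\<^esub> (w, h, f \<cdot> a) = \<phi> \<and>
        (f \<cdot> a, b, g) \<cdot>\<^bsub>slice C X\<^esub> (w, h, f \<cdot> a) = \<psi>"
        using h a' b' slice_hom_iff[OF w fa] Comp_assoc[OF h(1) a f] by (simp add: slice_simps(4))
      fix \<chi> assume \<chi>: "\<chi> \<in> hom (slice C X) w (f \<cdot> a) \<and>
        (f \<cdot> a, a, f) \<cdot>\<^bsub>slice C X\<^esub> \<chi> = \<phi> \<and> (f \<cdot> a, b, g) \<cdot>\<^bsub>slice C X\<^esub> \<chi> = \<psi>"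
      then show "\<chi> = (w, h, f \<cdot> a)"
        using slice_hom_iff[OF w fa] a'(1) b'(1) huniq by (cases \<chi>) (auto simp: slice_simps(4))
    qed
  qed
qed

end

section \<open>Calculus of chosen products, to be used both in \<open>C\<close> and in its
  slices\<close>

locale category_with_products = category +
  assumes products: "A \<in> Ob C \<Longrightarrow> B \<in> Ob C \<Longrightarrow> \<exists>P a b. is_product C A B P a b"
begin

lemma prod_is_product:
  assumes "A \<in> Ob C" "B \<in> Ob C"
  shows "is_product C A B (prod_ob C A B) (proj1 C A B) (proj2 C A B)"
proof -
  obtain P a b where "is_product C A B P a b" using products[OF assms] by blast
  then have "case (P, a, b) of (P, p, q) \<Rightarrow> is_product C A B P p q" by simp
  then have "case chosen_product C A B of (P, p, q) \<Rightarrow> is_product C A B P p q"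
    unfolding chosen_product_def by (rule someI)
  then show ?thesis
    by (simp add: prod_ob_def proj1_def proj2_def case_prod_unfold)
qed

lemma proj_hom:
  assumes "A \<in> Ob C" "B \<in> Ob C"
  shows "proj1 C A B \<in> hom C (prod_ob C A B) A" "proj2 C A B \<in> hom C (prod_ob C A B) B"
  using prod_is_product[OF assms] by (auto simp: is_product_def)

lemma prod_Ob: "A \<in> Ob C \<Longrightarrow> B \<in> Ob C \<Longrightarrow> prod_ob C A B \<in> Ob C"
  using prod_is_product by (auto simp: is_product_def)

lemma pairE:
  assumes "f \<in> hom C W A" "g \<in> hom C W B"
  obtains h where "h \<in> hom C W (prod_ob C A B)" "proj1 C A B \<cdot> h = f" "proj2 C A B \<cdot> h = g"
  using prod_is_product[of A B] assms hom_Ob[OF assms(1)] hom_Ob[OF assms(2)]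
  unfolding is_product_def by blast

lemma prod_eqI:
  assumes "A \<in> Ob C" "B \<in> Ob C"
    and "h \<in> hom C W (prod_ob C A B)" "k \<in> hom C W (prod_ob C A B)"
    and "proj1 C A B \<cdot> h = proj1 C A B \<cdot> k" "proj2 C A B \<cdot> h = proj2 C A B \<cdot> k"
  shows "h = k"
proof -
  have "proj1 C A B \<cdot> k \<in> hom C W A" "proj2 C A B \<cdot> k \<in> hom C W B"
    using Comp_hom[OF assms(4)] proj_hom[OF assms(1,2)] by auto
  then have "\<exists>!l. l \<in> hom C W (prod_ob C A B) \<and>
      proj1 C A B \<cdot> l = proj1 C A B \<cdot> k \<and> proj2 C A B \<cdot> l = proj2 C A B \<cdot> k"
    using prod_is_product[OF assms(1,2)] unfolding is_product_def by blast
  then show ?thesis using assms(3-) by blast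
qed

text \<open>The definite description defining \<open>prod_ar\<close> has a solution by the pairing
  property, and only one because the projections are jointly monic.\<close>

lemma prod_ar:
  assumes f: "f \<in> hom C A A'" and g: "g \<in> hom C B B'"
  shows "prod_ar C f g \<in> hom C (prod_ob C A B) (prod_ob C A' B')"
    and "proj1 C A' B' \<cdot> prod_ar C f g = f \<cdot> proj1 C A B"
    and "proj2 C A' B' \<cdot> prod_ar C f g = g \<cdot> proj2 C A B"
proof -
  have Ob: "A \<in> Ob C" "A' \<in> Ob C" "B \<in> Ob C" "B' \<in> Ob C"
    using hom_Ob f g by auto
  let ?P = "\<lambda>h. h \<in> hom C (prod_ob C A B) (prod_ob C A' B') \<and>
      proj1 C A' B' \<cdot> h = f \<cdot> proj1 C A B \<and> proj2 C A' B' \<cdot> h = g \<cdot> proj2 C A B"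
  obtain h where h: "?P h"
    using pairE[OF Comp_hom[OF proj_hom(1)[OF Ob(1,3)] f] Comp_hom[OF proj_hom(2)[OF Ob(1,3)] g]]
    by blast
  then have "\<exists>!h. ?P h"
    by (rule ex1I) (use h in \<open>auto intro: prod_eqI[OF Ob(2,4)]\<close>)
  then have "?P (THE h. ?P h)" by (rule theI')
  then show "prod_ar C f g \<in> hom C (prod_ob C A B) (prod_ob C A' B')"
    "proj1 C A' B' \<cdot> prod_ar C f g = f \<cdot> proj1 C A B"
    "proj2 C A' B' \<cdot> prod_ar C f g = g \<cdot> proj2 C A B"
    using hom_DomCod[OF f] hom_DomCod[OF g] by (simp_all add: prod_ar_def)
qed

lemma proj_prod_ar_Comp:
  assumes f: "f \<in> hom C A A'" and g: "g \<in> hom C B B'" and h: "h \<in> hom C W (prod_ob C A B)"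
  shows "proj1 C A' B' \<cdot> (prod_ar C f g \<cdot> h) = f \<cdot> (proj1 C A B \<cdot> h)"
    and "proj2 C A' B' \<cdot> (prod_ar C f g \<cdot> h) = g \<cdot> (proj2 C A B \<cdot> h)"
proof -
  have Ob: "A \<in> Ob C" "A' \<in> Ob C" "B \<in> Ob C" "B' \<in> Ob C"
    using hom_Ob f g by auto
  note pr = proj_hom[OF Ob(1,3)] and pr' = proj_hom[OF Ob(2,4)] and fg = prod_ar[OF f g]
  show "proj1 C A' B' \<cdot> (prod_ar C f g \<cdot> h) = f \<cdot> (proj1 C A B \<cdot> h)"
    using Comp_assoc[OF h fg(1) pr'(1)] Comp_assoc[OF h pr(1) f] fg by simp
  show "proj2 C A' B' \<cdot> (prod_ar C f g \<cdot> h) = g \<cdot> (proj2 C A B \<cdot> h)"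
    using Comp_assoc[OF h fg(1) pr'(2)] Comp_assoc[OF h pr(2) g] fg by simp
qed

lemma prod_ar_Comp:
  assumes f: "f \<in> hom C A A'" and f': "f' \<in> hom C A' A''"
    and g: "g \<in> hom C B B'" and g': "g' \<in> hom C B' B''"
  shows "prod_ar C f' g' \<cdot> prod_ar C f g = prod_ar C (f' \<cdot> f) (g' \<cdot> g)"
proof -
  have Ob: "A \<in> Ob C" "B \<in> Ob C" "A'' \<in> Ob C" "B'' \<in> Ob C"
    using hom_Ob f g f' g' by auto
  note pr = proj_hom[OF Ob(1,2)]
    and fg = prod_ar[OF f g] and fg' = prod_ar[OF f' g']
    and ffgg = prod_ar[OF Comp_hom[OF f f'] Comp_hom[OF g g']]
  show ?thesis
    using proj_prod_ar_Comp[OF f' g' fg(1)] Comp_assoc[OF pr(1) f f'] Comp_assoc[OF pr(2) g g']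
      fg ffgg
    by (intro prod_eqI[OF Ob(3,4) Comp_hom[OF fg(1) fg'(1)] ffgg(1)]) simp_all
qed

text \<open>Both sides equal \<open>prod_ar C f g\<close>. With \<open>g\<close> the arrow
  \<open>p\<close>, this lets a map in the first factor pass across the change from \<open>Y\<close>
  to \<open>X\<close> in the second.\<close>

lemma prod_ar_interchange:
  assumes f: "f \<in> hom C A A'" and g: "g \<in> hom C B B'"
  shows "prod_ar C (Idt C A') g \<cdot> prod_ar C f (Idt C B)
    = prod_ar C f (Idt C B') \<cdot> prod_ar C (Idt C A) g"
proof -
  have i: "Idt C A \<in> hom C A A" "Idt C A' \<in> hom C A' A'" "Idt C B \<in> hom C B B"
    "Idt C B' \<in> hom C B' B'"
    using hom_Ob Idt_hom f g by auto
  show ?thesis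
    by (simp add: prod_ar_Comp[OF f i(2) i(3) g] prod_ar_Comp[OF i(1) f g i(4)]
        Comp_Idt_left[OF f] Comp_Idt_right[OF f] Comp_Idt_left[OF g] Comp_Idt_right[OF g])
qed

text \<open>A compatible pair consists of an arrow to \<open>W \<times> X\<close> and an arrow
  \<open>b\<close> to \<open>Y\<close>; the \<open>X\<close>-component of the former is forced to be
  \<open>p \<cdot> b\<close>, so only a \<open>W\<close>-component and a \<open>Y\<close>-component
  remain.\<close>

lemma prod_pullback:
  assumes p: "p \<in> hom C Y X" and W: "W \<in> Ob C"
  shows "is_pullback C (proj2 C W X) p (prod_ob C W Y) (prod_ar C (Idt C W) p) (proj2 C W Y)"
proof -
  have Ob: "X \<in> Ob C" "Y \<in> Ob C" using hom_Ob p by auto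
  note X = proj_hom[OF W Ob(1)] and Y = proj_hom[OF W Ob(2)]
  note ip = prod_ar[OF Idt_hom[OF W] p] and c = proj_prod_ar_Comp[OF Idt_hom[OF W] p]
  show ?thesis
    unfolding is_pullback_def hom_DomCod[OF X(2), THEN conjunct1] hom_DomCod[OF p, THEN conjunct1]
  proof (intro conjI allI impI)
    show "prod_ob C W Y \<in> Ob C" by (rule prod_Ob[OF W Ob(2)])
    show "prod_ar C (Idt C W) p \<in> hom C (prod_ob C W Y) (prod_ob C W X)"
      "proj2 C W Y \<in> hom C (prod_ob C W Y) Y"
      "proj2 C W X \<cdot> prod_ar C (Idt C W) p = p \<cdot> proj2 C W Y"
      using ip Y by auto
    fix V a b
    assume a: "a \<in> hom C V (prod_ob C W X)" and b: "b \<in> hom C V Y"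
      and ab: "proj2 C W X \<cdot> a = p \<cdot> b"
    note aW = Comp_hom[OF a X(1)]
    obtain h where h: "h \<in> hom C V (prod_ob C W Y)" "proj1 C W Y \<cdot> h = proj1 C W X \<cdot> a"
        "proj2 C W Y \<cdot> h = b"
      using pairE[OF aW b] by blast
    \<comment> \<open>The components in \<open>W\<close> agree by the choice of \<open>h\<close>,
      those in \<open>X\<close> by the compatibility \<open>ab\<close>.\<close>
    have eq: "prod_ar C (Idt C W) p \<cdot> h = a"
      using c[OF h(1)] h ab Comp_Idt_left[OF aW]
      by (intro prod_eqI[OF W Ob(1) Comp_hom[OF h(1) ip(1)] a]) simp_all
    show "\<exists>!h. h \<in> hom C V (prod_ob C W Y) \<and> prod_ar C (Idt C W) p \<cdot> h = a \<and>
        proj2 C W Y \<cdot> h = b"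
    proof (rule ex1I[of _ h])
      show "h \<in> hom C V (prod_ob C W Y) \<and> prod_ar C (Idt C W) p \<cdot> h = a \<and> proj2 C W Y \<cdot> h = b"
        using h eq by blast
      fix k
      assume "k \<in> hom C V (prod_ob C W Y) \<and> prod_ar C (Idt C W) p \<cdot> k = a \<and>
        proj2 C W Y \<cdot> k = b"
      then have k: "k \<in> hom C V (prod_ob C W Y)" "prod_ar C (Idt C W) p \<cdot> k = a"
        "proj2 C W Y \<cdot> k = b" by auto
      have "proj1 C W Y \<cdot> k = proj1 C W X \<cdot> a"
        using c(1)[OF k(1)] Comp_Idt_left[OF Comp_hom[OF k(1) Y(1)]] k(2) by simp
      then show "k = h"
        using k h by (intro prod_eqI[OF W Ob(2) k(1) h(1)]) simp_all
    qed
  qed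
qed

end

section \<open>Exponentials\<close>

context category_with_products
begin

text \<open>The right adjoint at \<open>A\<close> is the exponential and the counit at
  \<open>A\<close> its evaluation; the transpose of \<open>g\<close> is
  \<open>onAr G g \<cdot> \<eta> W\<close>. One triangle identity with naturality of the counit
  gives existence, the other with naturality of the unit gives uniqueness.\<close>

lemma exponentiable_has_exponential:
  assumes "exponentiable C X" "A \<in> Ob C"
  shows "has_exponential C X A"
proof -
  obtain G \<eta> \<epsilon> where "adjunction C C (prod_functor C X) G \<eta> \<epsilon>"
    using assms(1) by (auto simp: exponentiable_def has_right_adjoint_def)
  then interpret adj: adjunction C C "prod_functor C X" G \<eta> \<epsilon> .
  let ?F = "prod_functor C X"
  have F: "onOb ?F B = prod_ob C B X" "onAr ?F f = prod_ar C f (Idt C X)" for B f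
    by (simp_all add: prod_functor_def)
  have GA: "onOb G A \<in> Ob C" using adj.G.onOb_Ob assms(2) .
  have \<epsilon>: "\<epsilon> B \<in> hom C (onOb ?F (onOb G B)) B" if "B \<in> Ob C" for B
    using adj.counit.component_hom[OF that] by (simp add: comp_functor_def id_functor_def)
  have \<eta>: "\<eta> B \<in> hom C B (onOb G (onOb ?F B))" if "B \<in> Ob C" for B
    using adj.unit.component_hom[OF that] by (simp add: comp_functor_def id_functor_def)
  have "is_exponential C X A (onOb G A) (\<epsilon> A)"
    unfolding is_exponential_def
  proof (intro conjI ballI)
    show "onOb G A \<in> Ob C" by (rule GA)
    show "\<epsilon> A \<in> hom C (prod_ob C (onOb G A) X) A"
      using \<epsilon>[OF assms(2)] F by simp
    fix W g assume W: "W \<in> Ob C" and "g \<in> hom C (prod_ob C W X) A"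
    then have g: "g \<in> hom C (onOb ?F W) A" using F by simp
    note FW = adj.F.onOb_Ob[OF W] and Gg = adj.G.onAr_hom[OF g]
    show "\<exists>!g'. g' \<in> hom C W (onOb G A) \<and> g = \<epsilon> A \<cdot> prod_ar C g' (Idt C X)"
    proof (rule ex1I[of _ "onAr G g \<cdot> \<eta> W"])
      have nat: "g \<cdot> \<epsilon> (onOb ?F W) = \<epsilon> A \<cdot> onAr ?F (onAr G g)"
        using adj.counit.naturality[OF g] by (simp add: comp_functor_def id_functor_def)
      note F\<eta> = adj.F.onAr_hom[OF \<eta>[OF W]]
      have "\<epsilon> A \<cdot> onAr ?F (onAr G g \<cdot> \<eta> W) = \<epsilon> A \<cdot> (onAr ?F (onAr G g) \<cdot> onAr ?F (\<eta> W))"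
        by (simp add: adj.F.onAr_Comp[OF \<eta>[OF W] Gg])
      also have "\<dots> = (\<epsilon> A \<cdot> onAr ?F (onAr G g)) \<cdot> onAr ?F (\<eta> W)"
        by (rule Comp_assoc[OF F\<eta> adj.F.onAr_hom[OF Gg] \<epsilon>[OF assms(2)], symmetric])
      also have "\<dots> = g \<cdot> (\<epsilon> (onOb ?F W) \<cdot> onAr ?F (\<eta> W))"
        unfolding nat[symmetric] by (rule Comp_assoc[OF F\<eta> \<epsilon>[OF FW] g])
      also have "\<dots> = g"
        using adj.triangle_left[OF W] Comp_Idt_right[OF g] by simp
      finally show "onAr G g \<cdot> \<eta> W \<in> hom C W (onOb G A) \<and>
          g = \<epsilon> A \<cdot> prod_ar C (onAr G g \<cdot> \<eta> W) (Idt C X)"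
        using Comp_hom[OF \<eta>[OF W] Gg] F by simp
      fix k assume "k \<in> hom C W (onOb G A) \<and> g = \<epsilon> A \<cdot> prod_ar C k (Idt C X)"
      then have k: "k \<in> hom C W (onOb G A)" and gk: "g = \<epsilon> A \<cdot> onAr ?F k"
        using F by auto
      note Fk = adj.F.onAr_hom[OF k] and G\<epsilon> = adj.G.onAr_hom[OF \<epsilon>[OF assms(2)]]
      have nat: "onAr G (onAr ?F k) \<cdot> \<eta> W = \<eta> (onOb G A) \<cdot> k"
        using adj.unit.naturality[OF k] by (simp add: comp_functor_def id_functor_def)
      have "onAr G g \<cdot> \<eta> W = (onAr G (\<epsilon> A) \<cdot> onAr G (onAr ?F k)) \<cdot> \<eta> W"
        unfolding gk by (simp add: adj.G.onAr_Comp[OF Fk \<epsilon>[OF assms(2)]])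
      also have "\<dots> = onAr G (\<epsilon> A) \<cdot> (\<eta> (onOb G A) \<cdot> k)"
        unfolding nat[symmetric] by (rule Comp_assoc[OF \<eta>[OF W] adj.G.onAr_hom[OF Fk] G\<epsilon>])
      also have "\<dots> = (onAr G (\<epsilon> A) \<cdot> \<eta> (onOb G A)) \<cdot> k"
        by (rule Comp_assoc[OF k \<eta>[OF GA] G\<epsilon>, symmetric])
      also have "\<dots> = k"
        using adj.triangle_right[OF assms(2)] Comp_Idt_left[OF k] by simp
      finally show "k = onAr G g \<cdot> \<eta> W" by simp
    qed
  qed
  then show ?thesis by (auto simp: has_exponential_def)
qed

text \<open>Frees the universal property from the chosen product of \<open>W\<close> and
  \<open>Y\<close>: any product diagram \<open>P\<close> will do. The arrow \<open>k\<close> plays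
  the role of \<open>g' \<times> id\<close>, now starting at \<open>P\<close>. This is needed in the
  slice, where the chosen product with \<open>p\<close> need not be the convenient one.\<close>

lemma exponential_transpose:
  assumes exp: "is_exponential C Y Z E ev" and Y: "Y \<in> Ob C"
    and P: "is_product C W Y P a b" and g: "g \<in> hom C P Z"
  shows "\<exists>!g'. g' \<in> hom C W E \<and>
    (\<exists>k \<in> hom C P (prod_ob C E Y). proj1 C E Y \<cdot> k = g' \<cdot> a \<and> proj2 C E Y \<cdot> k = b \<and> g = ev \<cdot> k)"
proof -
  have E: "E \<in> Ob C" and ev: "ev \<in> hom C (prod_ob C E Y) Z"
    using exp by (auto simp: is_exponential_def)
  have a: "a \<in> hom C P W" and b: "b \<in> hom C P Y"
    using P by (auto simp: is_product_def)
  have W: "W \<in> Ob C" using hom_Ob[OF a] by simp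
  note pr = proj_hom[OF W Y] and prE = proj_hom[OF E Y]
  \<comment> \<open>The comparison arrows \<open>i\<close> and \<open>j\<close> run between the
    chosen product and \<open>P\<close>; transposing \<open>g\<close> over \<open>P\<close> means
    transposing \<open>g \<cdot> i\<close> over the chosen product.\<close>
  have "\<exists>!i. i \<in> hom C (prod_ob C W Y) P \<and> a \<cdot> i = proj1 C W Y \<and> b \<cdot> i = proj2 C W Y"
    using P pr unfolding is_product_def by blast
  then obtain i where i: "i \<in> hom C (prod_ob C W Y) P" "a \<cdot> i = proj1 C W Y" "b \<cdot> i = proj2 C W Y"
    by blast
  obtain j where j: "j \<in> hom C P (prod_ob C W Y)" "proj1 C W Y \<cdot> j = a" "proj2 C W Y \<cdot> j = b"
    using pairE[OF a b] by blast
  have "\<exists>!l. l \<in> hom C P P \<and> a \<cdot> l = a \<and> b \<cdot> l = b"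
    using P a b unfolding is_product_def by blast
  moreover have "a \<cdot> (i \<cdot> j) = a" "b \<cdot> (i \<cdot> j) = b"
    using Comp_assoc[OF j(1) i(1) a] Comp_assoc[OF j(1) i(1) b] i j by auto
  ultimately have ij: "i \<cdot> j = Idt C P"
    using Comp_hom[OF j(1) i(1)] Idt_hom[of P] hom_Ob[OF a] Comp_Idt_right[OF a]
      Comp_Idt_right[OF b] by blast
  \<comment> \<open>Forwards the witness \<open>k\<close> is
    \<open>prod_ar C g' (Idt C Y) \<cdot> j\<close>; backwards, comparing projections gives
    \<open>k \<cdot> i = prod_ar C g' (Idt C Y)\<close>.\<close>
  have trans: "g \<cdot> i = ev \<cdot> prod_ar C g' (Idt C Y) \<longleftrightarrow>
      (\<exists>k \<in> hom C P (prod_ob C E Y).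
        proj1 C E Y \<cdot> k = g' \<cdot> a \<and> proj2 C E Y \<cdot> k = b \<and> g = ev \<cdot> k)"
    if g': "g' \<in> hom C W E" for g'
  proof
    note pa = prod_ar[OF g' Idt_hom[OF Y]]
    note paj = Comp_hom[OF j(1) pa(1)]
    {
      assume eq: "g \<cdot> i = ev \<cdot> prod_ar C g' (Idt C Y)"
      have "g = (g \<cdot> i) \<cdot> j"
        using Comp_assoc[OF j(1) i(1) g] ij Comp_Idt_right[OF g] by simp
      also have "\<dots> = ev \<cdot> (prod_ar C g' (Idt C Y) \<cdot> j)"
        unfolding eq by (rule Comp_assoc[OF j(1) pa(1) ev])
      finally have "g = ev \<cdot> (prod_ar C g' (Idt C Y) \<cdot> j)" .
      moreover have "proj1 C E Y \<cdot> (prod_ar C g' (Idt C Y) \<cdot> j) = g' \<cdot> a"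
        "proj2 C E Y \<cdot> (prod_ar C g' (Idt C Y) \<cdot> j) = b"
        using proj_prod_ar_Comp[OF g' Idt_hom[OF Y] j(1)] j Comp_Idt_left[OF b] by simp_all
      ultimately show "\<exists>k \<in> hom C P (prod_ob C E Y).
          proj1 C E Y \<cdot> k = g' \<cdot> a \<and> proj2 C E Y \<cdot> k = b \<and> g = ev \<cdot> k"
        using paj by blast
    }
    assume "\<exists>k \<in> hom C P (prod_ob C E Y).
        proj1 C E Y \<cdot> k = g' \<cdot> a \<and> proj2 C E Y \<cdot> k = b \<and> g = ev \<cdot> k"
    then obtain k where k: "k \<in> hom C P (prod_ob C E Y)" "proj1 C E Y \<cdot> k = g' \<cdot> a"
      "proj2 C E Y \<cdot> k = b" "g = ev \<cdot> k" by blast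
    have "k \<cdot> i = prod_ar C g' (Idt C Y)"
      using Comp_assoc[OF i(1) k(1) prE(1)] Comp_assoc[OF i(1) k(1) prE(2)]
        Comp_assoc[OF i(1) a g'] k i pa Comp_Idt_left[OF pr(2)]
      by (intro prod_eqI[OF E Y Comp_hom[OF i(1) k(1)] pa(1)]) simp_all
    then show "g \<cdot> i = ev \<cdot> prod_ar C g' (Idt C Y)"
      using Comp_assoc[OF i(1) k(1) ev] k(4) by simp
  qed
  have "\<exists>!g'. g' \<in> hom C W E \<and> g \<cdot> i = ev \<cdot> prod_ar C g' (Idt C Y)"
    using exp W Comp_hom[OF i(1) g] unfolding is_exponential_def by blast
  then show ?thesis
    using trans by (metis (no_types, lifting))
qed

end

section \<open>Exponentials in the slice, described by arrows of the base\<close>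

lemma (in category) slice_category_with_products:
  assumes "has_finite_limits C"
  shows "category_with_products (slice C X)"
proof -
  have "\<exists>r \<phi> \<psi>. is_product (slice C X) f g r \<phi> \<psi>"
    if "f \<in> Ob (slice C X)" "g \<in> Ob (slice C X)" for f g
    using that pullback_exists[OF assms] slice_product_of_pullback by (metis slice_ObE)
  then show ?thesis
    by (simp add: category_with_products_def category_with_products_axioms_def category_slice)
qed

context category_with_products
begin

text \<open>Arrows over \<open>X\<close> into \<open>Z \<times> X\<close> are just arrows into \<open>Z\<close>; this is what lets the exponential
  in the slice be expressed in \<open>C\<close>.\<close>

lemma slice_exponential_unfolded:
  assumes lim: "has_finite_limits C" and p: "p \<in> hom C Y X" and Z: "Z \<in> Ob C"
    and exp: "has_exponential (slice C X) p (proj2 C Z X)"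
  obtains E q R r s e where
    "q \<in> hom C E X" "r \<in> hom C R E" "s \<in> hom C R Y" "e \<in> hom C R Z"
    "is_pullback C q p R r s"
    "\<And>V w P a b g. w \<in> hom C V X \<Longrightarrow> is_pullback C w p P a b \<Longrightarrow> g \<in> hom C P Z \<Longrightarrow>
      \<exists>!h. h \<in> hom C V E \<and> q \<cdot> h = w \<and>
        (\<exists>k \<in> hom C P R. r \<cdot> k = h \<cdot> a \<and> s \<cdot> k = b \<and> g = e \<cdot> k)"
proof -
  interpret S: category_with_products "slice C X"
    by (rule slice_category_with_products[OF lim])
  obtain q ev where qe: "is_exponential (slice C X) p (proj2 C Z X) q ev"
    using exp by (auto simp: has_exponential_def)
  have X: "X \<in> Ob C" using hom_Ob p by blast
  note prZ = proj_hom[OF Z X]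
  have p_Ob: "p \<in> Ob (slice C X)" and q_Ob: "q \<in> Ob (slice C X)"
    using p qe by (simp_all add: slice_simps hom_def is_exponential_def)
  obtain E where q: "q \<in> hom C E X" using q_Ob by (rule slice_ObE)
  \<comment> \<open>The slice object underlying the domain of \<open>ev\<close>: an arrow
    \<open>t\<close> from some \<open>R\<close> to \<open>X\<close>. Its projections are carried by
    \<open>r\<close> and \<open>s\<close>.\<close>
  define t where "t = prod_ob (slice C X) q p"
  obtain R where t: "t \<in> hom C R X"
    using S.prod_Ob[OF q_Ob p_Ob] slice_ObE t_def by blast
  note pr = S.proj_hom[OF q_Ob p_Ob, folded t_def]
  obtain r where r: "proj1 (slice C X) q p = (t, r, q)" "r \<in> hom C R E" "q \<cdot> r = t"
    using pr(1) slice_hom_iff[OF t q] by (cases "proj1 (slice C X) q p") auto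
  obtain s where s: "proj2 (slice C X) q p = (t, s, p)" "s \<in> hom C R Y" "p \<cdot> s = t"
    using pr(2) slice_hom_iff[OF t p] by (cases "proj2 (slice C X) q p") auto
  obtain e' where e': "ev = (t, e', proj2 C Z X)" "e' \<in> hom C R (prod_ob C Z X)"
      "proj2 C Z X \<cdot> e' = t"
    using qe slice_hom_iff[OF t prZ(2)] unfolding is_exponential_def t_def[symmetric]
    by (cases ev) auto
  \<comment> \<open>Only the \<open>Z\<close>-component of the evaluation carries information: its
    \<open>X\<close>-component is \<open>t\<close>, because \<open>ev\<close> is an arrow over
    \<open>X\<close>.\<close>
  define e where "e = proj1 C Z X \<cdot> e'"
  have e: "e \<in> hom C R Z"
    unfolding e_def by (rule Comp_hom[OF e'(2) prZ(1)])
  have tprod: "is_product (slice C X) q p t (t, r, q) (t, s, p)"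
    using S.prod_is_product[OF q_Ob p_Ob] r s t_def by simp
  \<comment> \<open>The converse of \<open>slice_product_of_pullback\<close>, for the chosen
    product: a commuting square with diagonal \<open>q \<cdot> a\<close> is a pair of slice arrows
    out of \<open>q \<cdot> a\<close>.\<close>
  have pb: "is_pullback C q p R r s"
    unfolding is_pullback_def hom_DomCod[OF q, THEN conjunct1] hom_DomCod[OF p, THEN conjunct1]
  proof (intro conjI allI impI)
    show "R \<in> Ob C" "r \<in> hom C R E" "s \<in> hom C R Y" "q \<cdot> r = p \<cdot> s"
      using r s hom_Ob by auto
    fix V a b assume a: "a \<in> hom C V E" and b: "b \<in> hom C V Y" and ab: "q \<cdot> a = p \<cdot> b"
    note w = Comp_hom[OF a q]
    have "(q \<cdot> a, a, q) \<in> hom (slice C X) (q \<cdot> a) q" "(q \<cdot> a, b, p) \<in> hom (slice C X) (q \<cdot> a) p"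
      using slice_hom_iff[OF w q] slice_hom_iff[OF w p] a b ab by auto
    then have ex: "\<exists>!\<chi>. \<chi> \<in> hom (slice C X) (q \<cdot> a) t \<and>
        (t, r, q) \<cdot>\<^bsub>slice C X\<^esub> \<chi> = (q \<cdot> a, a, q) \<and> (t, s, p) \<cdot>\<^bsub>slice C X\<^esub> \<chi> = (q \<cdot> a, b, p)"
      using tprod unfolding is_product_def by blast
    have iff: "(q \<cdot> a, h, t) \<in> hom (slice C X) (q \<cdot> a) t \<and>
        (t, r, q) \<cdot>\<^bsub>slice C X\<^esub> (q \<cdot> a, h, t) = (q \<cdot> a, a, q) \<and>
        (t, s, p) \<cdot>\<^bsub>slice C X\<^esub> (q \<cdot> a, h, t) = (q \<cdot> a, b, p)
        \<longleftrightarrow> h \<in> hom C V R \<and> r \<cdot> h = a \<and> s \<cdot> h = b" for h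
      using Comp_assoc[OF _ r(2) q, of h V] r(3)
      by (auto simp: slice_hom_iff[OF w t] slice_simps(4))
    obtain \<chi> where \<chi>: "\<chi> \<in> hom (slice C X) (q \<cdot> a) t"
        "(t, r, q) \<cdot>\<^bsub>slice C X\<^esub> \<chi> = (q \<cdot> a, a, q)" "(t, s, p) \<cdot>\<^bsub>slice C X\<^esub> \<chi> = (q \<cdot> a, b, p)"
      using ex by blast
    obtain h where h: "\<chi> = (q \<cdot> a, h, t)"
      using \<chi>(1) by (rule slice_homE)
    show "\<exists>!h. h \<in> hom C V R \<and> r \<cdot> h = a \<and> s \<cdot> h = b"
    proof (rule ex1I[of _ h])
      show "h \<in> hom C V R \<and> r \<cdot> h = a \<and> s \<cdot> h = b"
        using iff[of h] \<chi> h by blast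
      fix k assume "k \<in> hom C V R \<and> r \<cdot> k = a \<and> s \<cdot> k = b"
      then have "(q \<cdot> a, k, t) = (q \<cdot> a, h, t)"
        using iff[of k] ex \<chi> unfolding h by blast
      then show "k = h" by simp
    qed
  qed
  have univ: "\<exists>!h. h \<in> hom C V E \<and> q \<cdot> h = w \<and>
        (\<exists>k \<in> hom C P R. r \<cdot> k = h \<cdot> a \<and> s \<cdot> k = b \<and> g = e \<cdot> k)"
    if w: "w \<in> hom C V X" and P: "is_pullback C w p P a b" and g: "g \<in> hom C P Z"
    for V w P a b g
  proof -
    have a: "a \<in> hom C P V" and b: "b \<in> hom C P Y" and ab: "w \<cdot> a = p \<cdot> b"
      using P hom_DomCod[OF w] hom_DomCod[OF p] by (auto simp: is_pullback_def)
    note wa = Comp_hom[OF a w]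
    \<comment> \<open>Pairing \<open>g\<close> with the structure arrow \<open>w \<cdot> a\<close>
      makes it an arrow over \<open>X\<close> into \<open>Z \<times> X\<close>, whose transpose the
      slice exponential provides.\<close>
    obtain g' where g': "g' \<in> hom C P (prod_ob C Z X)" "proj1 C Z X \<cdot> g' = g"
        "proj2 C Z X \<cdot> g' = w \<cdot> a"
      using pairE[OF g wa] by blast
    let ?\<gamma> = "(w \<cdot> a, g', proj2 C Z X)"
    let ?Q = "\<lambda>\<phi>. \<phi> \<in> hom (slice C X) w q \<and> (\<exists>\<kappa> \<in> hom (slice C X) (w \<cdot> a) t.
        (t, r, q) \<cdot>\<^bsub>slice C X\<^esub> \<kappa> = \<phi> \<cdot>\<^bsub>slice C X\<^esub> (w \<cdot> a, a, w) \<and>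
        (t, s, p) \<cdot>\<^bsub>slice C X\<^esub> \<kappa> = (w \<cdot> a, b, p) \<and> ?\<gamma> = ev \<cdot>\<^bsub>slice C X\<^esub> \<kappa>)"
    have "?\<gamma> \<in> hom (slice C X) (w \<cdot> a) (proj2 C Z X)"
      using slice_hom_iff[OF wa prZ(2)] g' by simp
    then have ex: "\<exists>!\<phi>. ?Q \<phi>"
      using S.exponential_transpose[OF qe p_Ob slice_product_of_pullback[OF w p P]]
      unfolding r(1) s(1) t_def[symmetric] by blast
    \<comment> \<open>Translates the transposition property from triples to underlying arrows, so
      that unique existence can be carried over to \<open>h\<close>.\<close>
    have iff: "?Q (w, h, q) \<longleftrightarrow> h \<in> hom C V E \<and> q \<cdot> h = w \<and>
        (\<exists>k \<in> hom C P R. r \<cdot> k = h \<cdot> a \<and> s \<cdot> k = b \<and> g = e \<cdot> k)" (is "_ = ?N h") for h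
    proof
      assume Q: "?Q (w, h, q)"
      then have h: "h \<in> hom C V E" "q \<cdot> h = w"
        using slice_hom_iff[OF w q] by auto
      from Q obtain \<kappa> where \<kappa>: "\<kappa> \<in> hom (slice C X) (w \<cdot> a) t"
        "(t, r, q) \<cdot>\<^bsub>slice C X\<^esub> \<kappa> = (w, h, q) \<cdot>\<^bsub>slice C X\<^esub> (w \<cdot> a, a, w)"
        "(t, s, p) \<cdot>\<^bsub>slice C X\<^esub> \<kappa> = (w \<cdot> a, b, p)" "?\<gamma> = ev \<cdot>\<^bsub>slice C X\<^esub> \<kappa>"
        by blast
      obtain k where k: "\<kappa> = (w \<cdot> a, k, t)" "k \<in> hom C P R"
        using \<kappa>(1) slice_hom_iff[OF wa t] by (cases \<kappa>) auto
      have "r \<cdot> k = h \<cdot> a" "s \<cdot> k = b" "g' = e' \<cdot> k"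
        using \<kappa>(2-4) unfolding k(1) e'(1) by (simp_all add: slice_simps(4))
      moreover from this have "g = e \<cdot> k"
        unfolding e_def using Comp_assoc[OF k(2) e'(2) prZ(1)] g'(2) by simp
      ultimately show "?N h" using h k(2) by blast
    next
      assume "?N h"
      then obtain k where h: "h \<in> hom C V E" "q \<cdot> h = w" and k: "k \<in> hom C P R"
        "r \<cdot> k = h \<cdot> a" "s \<cdot> k = b" "g = e \<cdot> k" by blast
      have tk: "t \<cdot> k = w \<cdot> a"
        using Comp_assoc[OF k(1) r(2) q] Comp_assoc[OF a h(1) q] r(3) k(2) h(2) by simp
      \<comment> \<open>The \<open>Z\<close>-components agree by assumption on \<open>k\<close>; the
        \<open>X\<close>-components agree because both sides lie over \<open>X\<close>, which is
        \<open>tk\<close>.\<close>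
      have "g' = e' \<cdot> k"
        using Comp_assoc[OF k(1) e'(2) prZ(1)] Comp_assoc[OF k(1) e'(2) prZ(2)] g' k(4) e'(3) tk
        by (intro prod_eqI[OF Z X g'(1) Comp_hom[OF k(1) e'(2)]]) (simp_all add: e_def)
      then have "(t, r, q) \<cdot>\<^bsub>slice C X\<^esub> (w \<cdot> a, k, t) = (w, h, q) \<cdot>\<^bsub>slice C X\<^esub> (w \<cdot> a, a, w)"
        "(t, s, p) \<cdot>\<^bsub>slice C X\<^esub> (w \<cdot> a, k, t) = (w \<cdot> a, b, p)"
        "?\<gamma> = ev \<cdot>\<^bsub>slice C X\<^esub> (w \<cdot> a, k, t)"
        using k e'(1) by (simp_all add: slice_simps(4))
      moreover have "(w \<cdot> a, k, t) \<in> hom (slice C X) (w \<cdot> a) t" "(w, h, q) \<in> hom (slice C X) w q"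
        using slice_hom_iff[OF wa t] slice_hom_iff[OF w q] k(1) tk h by auto
      ultimately show "?Q (w, h, q)" by blast
    qed
    obtain \<phi> where \<phi>: "?Q \<phi>" using ex by blast
    then obtain h where h: "\<phi> = (w, h, q)" by (blast elim: slice_homE)
    show ?thesis
    proof (rule ex1I[of _ h])
      show "?N h" using iff[of h] \<phi> unfolding h by blast
      fix h' assume "?N h'"
      then have "?Q (w, h', q)" using iff[of h'] by blast
      then have "(w, h', q) = (w, h, q)" using ex \<phi> unfolding h by blast
      then show "h' = h" by simp
    qed
  qed
  show thesis by (rule that[OF q r(2) s(2) e pb univ])
qed

text \<open>The value at \<open>q\<close> of the right adjoint of \<open>- \<times> X\<close> from \<open>C\<close> to the slice; \<open>c\<close> is the
  counit.\<close>

lemma object_of_sections: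
  assumes lim: "has_finite_limits C" and X: "exponentiable C X" and q: "q \<in> hom C E X"
  obtains S c where "S \<in> Ob C" "c \<in> hom C (prod_ob C S X) E" "q \<cdot> c = proj2 C S X"
    "\<And>W h. W \<in> Ob C \<Longrightarrow> h \<in> hom C (prod_ob C W X) E \<Longrightarrow> q \<cdot> h = proj2 C W X \<Longrightarrow>
      \<exists>!g. g \<in> hom C W S \<and> h = c \<cdot> prod_ar C g (Idt C X)"
proof -
  have XO: "X \<in> Ob C" and EO: "E \<in> Ob C" using hom_Ob[OF q] by auto
  note iX = Idt_hom[OF XO]
  obtain T ev where T: "is_exponential C X E T ev"
    using exponentiable_has_exponential[OF X EO] by (auto simp: has_exponential_def)
  obtain T' ev' where T': "is_exponential C X X T' ev'"
    using exponentiable_has_exponential[OF X XO] by (auto simp: has_exponential_def)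
  have TO: "T \<in> Ob C" and ev: "ev \<in> hom C (prod_ob C T X) E"
    and TO': "T' \<in> Ob C" and ev': "ev' \<in> hom C (prod_ob C T' X) X"
    using T T' by (auto simp: is_exponential_def)
  note pT = proj_hom[OF TO XO]
  \<comment> \<open>With \<open>T\<close> as \<open>E\<^sup>X\<close> and \<open>T'\<close> as
    \<open>X\<^sup>X\<close>, \<open>u\<close> is postcomposition with \<open>q\<close> and
    \<open>v\<close> is constant at the name of the identity of \<open>X\<close>.\<close>
  obtain u where u: "u \<in> hom C T T'" "q \<cdot> ev = ev' \<cdot> prod_ar C u (Idt C X)"
    using T' TO Comp_hom[OF ev q] unfolding is_exponential_def by blast
  obtain v where v: "v \<in> hom C T T'" "proj2 C T X = ev' \<cdot> prod_ar C v (Idt C X)"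
    using T' TO pT(2) unfolding is_exponential_def by blast
  obtain S m where S: "is_equalizer C u v S m"
    using equalizer_exists[OF lim u(1) v(1)] by blast
  have SO: "S \<in> Ob C" and m: "m \<in> hom C S T" and um: "u \<cdot> m = v \<cdot> m"
    using S hom_DomCod[OF u(1)] by (auto simp: is_equalizer_def)
  have comp: "ev' \<cdot> prod_ar C (x \<cdot> n) (Idt C X) = (ev' \<cdot> prod_ar C x (Idt C X)) \<cdot> prod_ar C n (Idt C X)"
    if "n \<in> hom C W T" "x \<in> hom C T T'" for W n x
    using prod_ar_Comp[OF that iX iX] Comp_Idt_left[OF iX]
      Comp_assoc[OF prod_ar(1)[OF that(1) iX] prod_ar(1)[OF that(2) iX] ev'] by simp
  \<comment> \<open>The two sides of the right-hand equation are the untransposed forms of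
    \<open>u \<cdot> n\<close> and \<open>v \<cdot> n\<close>. Uniqueness of transposes into
    \<open>T'\<close> thus identifies equalizing arrows with the transposes of arrows over
    \<open>X\<close>.\<close>
  have equalizes: "u \<cdot> n = v \<cdot> n \<longleftrightarrow> q \<cdot> (ev \<cdot> prod_ar C n (Idt C X)) = proj2 C W X"
    if W: "W \<in> Ob C" and n: "n \<in> hom C W T" for W n
  proof -
    note pn = prod_ar[OF n iX] and pW = proj_hom[OF W XO]
    have uu: "ev' \<cdot> prod_ar C (u \<cdot> n) (Idt C X) = q \<cdot> (ev \<cdot> prod_ar C n (Idt C X))"
      using comp[OF n u(1)] u(2) Comp_assoc[OF pn(1) ev q] by simp
    have vv: "ev' \<cdot> prod_ar C (v \<cdot> n) (Idt C X) = proj2 C W X"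
      using comp[OF n v(1)] v(2) pn(3) Comp_Idt_left[OF pW(2)] by simp
    have "\<exists>!k. k \<in> hom C W T' \<and> proj2 C W X = ev' \<cdot> prod_ar C k (Idt C X)"
      using T' W pW(2) unfolding is_exponential_def by blast
    then have "u \<cdot> n = v \<cdot> n"
      if "ev' \<cdot> prod_ar C (u \<cdot> n) (Idt C X) = proj2 C W X"
      using that vv Comp_hom[OF n u(1)] Comp_hom[OF n v(1)] by metis
    then show ?thesis
      using uu vv by metis
  qed
  define c where "c = ev \<cdot> prod_ar C m (Idt C X)"
  note pm = prod_ar[OF m iX]
  show thesis
  proof (rule that[OF SO])
    show "c \<in> hom C (prod_ob C S X) E"
      unfolding c_def by (rule Comp_hom[OF pm(1) ev])
    show "q \<cdot> c = proj2 C S X"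
      unfolding c_def using equalizes[OF SO m] um by simp
    fix W h assume W: "W \<in> Ob C" and h: "h \<in> hom C (prod_ob C W X) E" "q \<cdot> h = proj2 C W X"
    have ex: "\<exists>!n. n \<in> hom C W T \<and> h = ev \<cdot> prod_ar C n (Idt C X)"
      using T W h(1) unfolding is_exponential_def by blast
    then obtain n where n: "n \<in> hom C W T" "h = ev \<cdot> prod_ar C n (Idt C X)" by blast
    have "u \<cdot> n = v \<cdot> n" using equalizes[OF W n(1)] n(2) h(2) by simp
    then have ex': "\<exists>!g. g \<in> hom C W S \<and> m \<cdot> g = n"
      using S n(1) hom_DomCod[OF u(1)] unfolding is_equalizer_def by simp
    \<comment> \<open>The right side of the first equation is the untransposed
      \<open>m \<cdot> g\<close>, and \<open>n\<close> is the only transpose of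
      \<open>h\<close>.\<close>
    have "h = c \<cdot> prod_ar C g (Idt C X) \<longleftrightarrow> m \<cdot> g = n" if g: "g \<in> hom C W S" for g
    proof -
      have "c \<cdot> prod_ar C g (Idt C X) = ev \<cdot> prod_ar C (m \<cdot> g) (Idt C X)"
        unfolding c_def using Comp_assoc[OF prod_ar(1)[OF g iX] pm(1) ev]
          prod_ar_Comp[OF g m iX iX] Comp_Idt_left[OF iX] by simp
      then show ?thesis using ex n Comp_hom[OF g m] by auto
    qed
    with ex' show "\<exists>!g. g \<in> hom C W S \<and> h = c \<cdot> prod_ar C g (Idt C X)"
      by (metis (no_types, lifting))
  qed
qed

text \<open>The evaluation of \<open>S\<close> is \<open>e \<cdot> k0\<close>: first evaluate the
  section at \<open>p y\<close> through \<open>c\<close>, landing in the fibre of \<open>q\<close>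
  over \<open>p y\<close>, then evaluate the result at \<open>y\<close> through
  \<open>e\<close>.\<close>

lemma exponential_of_slice_exponential:
  assumes lim: "has_finite_limits C" and X: "exponentiable C X" and p: "p \<in> hom C Y X"
    and Z: "Z \<in> Ob C" and exp: "has_exponential (slice C X) p (proj2 C Z X)"
  shows "has_exponential C Y Z"
proof -
  have XO: "X \<in> Ob C" and Y: "Y \<in> Ob C" using hom_Ob[OF p] by auto
  note iX = Idt_hom[OF XO] and iY = Idt_hom[OF Y]
  obtain E q R r s e where q: "q \<in> hom C E X" and r: "r \<in> hom C R E" and s: "s \<in> hom C R Y"
    and e: "e \<in> hom C R Z" and R: "is_pullback C q p R r s"
    and slice_univ: "\<And>V w P a b g. w \<in> hom C V X \<Longrightarrow> is_pullback C w p P a b \<Longrightarrow>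
      g \<in> hom C P Z \<Longrightarrow> \<exists>!h. h \<in> hom C V E \<and> q \<cdot> h = w \<and>
        (\<exists>k \<in> hom C P R. r \<cdot> k = h \<cdot> a \<and> s \<cdot> k = b \<and> g = e \<cdot> k)"
    by (rule slice_exponential_unfolded[OF lim p Z exp], rule that)
  obtain S c where S: "S \<in> Ob C" and c: "c \<in> hom C (prod_ob C S X) E" "q \<cdot> c = proj2 C S X"
    and sections: "\<And>W h. W \<in> Ob C \<Longrightarrow> h \<in> hom C (prod_ob C W X) E \<Longrightarrow> q \<cdot> h = proj2 C W X \<Longrightarrow>
      \<exists>!g. g \<in> hom C W S \<and> h = c \<cdot> prod_ar C g (Idt C X)"
    by (rule object_of_sections[OF lim X q], rule that)
  have pullback: "\<exists>!k. k \<in> hom C V R \<and> r \<cdot> k = a \<and> s \<cdot> k = b"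
    if "a \<in> hom C V E" "b \<in> hom C V Y" "q \<cdot> a = p \<cdot> b" for V a b
    using R that hom_DomCod[OF q] hom_DomCod[OF p] unfolding is_pullback_def by simp
  let ?b = "\<lambda>W. prod_ar C (Idt C W) p"
  have b: "?b W \<in> hom C (prod_ob C W Y) (prod_ob C W X)"
    "proj2 C W X \<cdot> ?b W = p \<cdot> proj2 C W Y" if "W \<in> Ob C" for W
    using prod_ar[OF Idt_hom[OF that] p] by auto
  have over: "q \<cdot> (h \<cdot> ?b W) = p \<cdot> proj2 C W Y"
    if "W \<in> Ob C" "h \<in> hom C (prod_ob C W X) E" "q \<cdot> h = proj2 C W X" for W h
    using Comp_assoc[OF b(1)[OF that(1)] that(2) q] b(2)[OF that(1)] that(3) by simp
  note pS = proj_hom[OF S Y]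
  \<comment> \<open>Informally, \<open>k0\<close> sends a section \<open>\<sigma>\<close> and a
    point \<open>y\<close> to the pair of \<open>\<sigma> (p y)\<close> and
    \<open>y\<close>.\<close>
  obtain k0 where k0: "k0 \<in> hom C (prod_ob C S Y) R" "r \<cdot> k0 = c \<cdot> ?b S" "s \<cdot> k0 = proj2 C S Y"
    using pullback[OF Comp_hom[OF b(1)[OF S] c(1)] pS(2) over[OF S c]] by blast
  have "is_exponential C Y Z S (e \<cdot> k0)"
    unfolding is_exponential_def
  proof (intro conjI ballI)
    show "S \<in> Ob C" "e \<cdot> k0 \<in> hom C (prod_ob C S Y) Z"
      using S Comp_hom[OF k0(1) e] by auto
    fix W g assume W: "W \<in> Ob C" and g: "g \<in> hom C (prod_ob C W Y) Z"
    note pW = proj_hom[OF W Y] and pX = proj_hom[OF W XO]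
    \<comment> \<open>States that \<open>h\<close> is the transpose of \<open>g\<close> in the
      slice, with \<open>W \<times> Y\<close> as the pullback of \<open>W \<times> X\<close> along
      \<open>p\<close>.\<close>
    let ?N = "\<lambda>h. h \<in> hom C (prod_ob C W X) E \<and> q \<cdot> h = proj2 C W X \<and>
        (\<exists>k \<in> hom C (prod_ob C W Y) R. r \<cdot> k = h \<cdot> ?b W \<and> s \<cdot> k = proj2 C W Y \<and> g = e \<cdot> k)"
    have ex: "\<exists>!h. ?N h"
      by (rule slice_univ[OF pX(2) prod_pullback[OF p W] g])
    then obtain h where h: "?N h" by blast
    have ex': "\<exists>!g'. g' \<in> hom C W S \<and> h = c \<cdot> prod_ar C g' (Idt C X)"
      using sections[OF W] h by blast
    \<comment> \<open>This equivalence carries the unique factorization of \<open>h\<close> through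
      \<open>c\<close> over to \<open>g\<close>. Below, \<open>h'\<close> is the arrow over
      \<open>X\<close> corresponding to \<open>g'\<close>, and \<open>k'\<close> is the associated
      arrow into \<open>R\<close>.\<close>
    have "g = (e \<cdot> k0) \<cdot> prod_ar C g' (Idt C Y) \<longleftrightarrow> h = c \<cdot> prod_ar C g' (Idt C X)"
      if g': "g' \<in> hom C W S" for g'
    proof -
      note gY = prod_ar[OF g' iY] and gX = prod_ar[OF g' iX]
      define h' where "h' = c \<cdot> prod_ar C g' (Idt C X)"
      define k' where "k' = k0 \<cdot> prod_ar C g' (Idt C Y)"
      have h': "h' \<in> hom C (prod_ob C W X) E" "q \<cdot> h' = proj2 C W X"
        unfolding h'_def
        using Comp_hom[OF gX(1) c(1)] Comp_assoc[OF gX(1) c(1) q] c(2) gX(3) Comp_Idt_left[OF pX(2)]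
        by auto
      have k': "k' \<in> hom C (prod_ob C W Y) R" "s \<cdot> k' = proj2 C W Y"
        unfolding k'_def
        using Comp_hom[OF gY(1) k0(1)] Comp_assoc[OF gY(1) k0(1) s] k0(3) gY(3)
          Comp_Idt_left[OF pW(2)] by auto
      have "r \<cdot> k' = (c \<cdot> ?b S) \<cdot> prod_ar C g' (Idt C Y)"
        unfolding k'_def using Comp_assoc[OF gY(1) k0(1) r] k0(2) by simp
      also have "\<dots> = c \<cdot> (?b S \<cdot> prod_ar C g' (Idt C Y))"
        by (rule Comp_assoc[OF gY(1) b(1)[OF S] c(1)])
      also have "\<dots> = c \<cdot> (prod_ar C g' (Idt C X) \<cdot> ?b W)"
        by (simp add: prod_ar_interchange[OF g' p])
      also have "\<dots> = h' \<cdot> ?b W"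
        unfolding h'_def by (rule Comp_assoc[OF b(1)[OF W] gX(1) c(1), symmetric])
      finally have rk': "r \<cdot> k' = h' \<cdot> ?b W" .
      have k'_uniq: "k = k'"
        if "k \<in> hom C (prod_ob C W Y) R" "r \<cdot> k = h' \<cdot> ?b W" "s \<cdot> k = proj2 C W Y" for k
        using pullback[OF Comp_hom[OF b(1)[OF W] h'(1)] pW(2) over[OF W h']] that k' rk' by blast
      \<comment> \<open>By the pullback property \<open>k'\<close> is the only candidate for the
        witness in \<open>?N h'\<close>, so the existential reduces to one equation.\<close>
      have "?N h' \<longleftrightarrow> g = e \<cdot> k'"
        using h' k' rk' k'_uniq by blast
      moreover have "?N h' \<longleftrightarrow> h = h'"
        using ex h by blast
      moreover have "e \<cdot> k' = (e \<cdot> k0) \<cdot> prod_ar C g' (Idt C Y)"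
        unfolding k'_def by (rule Comp_assoc[OF gY(1) k0(1) e, symmetric])
      ultimately show ?thesis unfolding h'_def by simp
    qed
    with ex' show "\<exists>!g'. g' \<in> hom C W S \<and> g = (e \<cdot> k0) \<cdot> prod_ar C g' (Idt C Y)"
      by (metis (no_types, lifting))
  qed
  then show ?thesis by (auto simp: has_exponential_def)
qed

end

theorem theorem7:
  fixes C :: "('o, 'm) category_data" and X Y Z :: 'o and p :: 'm
  assumes "category C"
    and "has_finite_limits C"
    and "exponentiable C X"
    and "p \<in> hom C Y X"
    and "Z \<in> Ob C"
    and "has_exponential (slice C X) p (proj2 C Z X)"
  shows "has_exponential C Y Z"
proof -
  interpret category C by fact
  interpret category_with_products C
    by unfold_locales (rule product_exists[OF assms(2)])
  show ?thesis
    by (rule exponential_of_slice_exponential) fact+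
qed

end
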